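(* Let $G=(V,E)$ be a finite simple graph on $V=\{x_1,\ldots,x_n\}$ with at least one edge, with chromatic number $\chi(G)$ and clique number $\omega(G)$. Then $$\frac{\chi(G)}{\chi(G)-1}\ \le\ \widehat\alpha(I(G))\ \le\ \frac{\omega(G)}{\omega(G)-1}.$$
   Context: $k$ is an algebraically closed field of any characteristic and $R=k[x_1,\ldots,x_n]$. The edge ideal of $G$ is $I(G)=\langle x_ix_j\mid\{x_i,x_j\}\in E\rangle\subseteq R$. The chromatic number $\chi(G)$ is the smallest number of colours in a colouring of $V$ with no two adjacent vertices of the same colour; the clique number $\omega(G)$ is the largest number of vertices in a set of pairwise adjacent vertices. For a nonzero homogeneous ideal $J\subseteq R$: $\alpha(J)=\min\{d\mid J_d\neq 0\}$ is the smallest degree of a nonzero element of $J$; the $m$-th symbolic power is $J^{(m)}=\bigcap_{P\in \mathrm{Ass}(J)}(J^mR_P\cap R)$; the Waldschmidt constant is $\widehat\alpha(J)=\lim_{m\to\infty}\alpha(J^{(m)})/m$ (the limit exists). *)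

theory Defs
  imports Complex_Main "HOL-Library.Poly_Mapping"
    "HOL-Computational_Algebra.Polynomial"
    "HOL-Computational_Algebra.Fraction_Field"
begin

section \<open>Finite simple graphs\<close>

text \<open>
  The vertex set is the whole of a finite type, whose elements also index the variables of the
  polynomial ring; a graph is given by its set of edges.
\<close>

definition simple_graph :: "'v set set \<Rightarrow> bool" where
  "simple_graph E \<longleftrightarrow> (\<forall>e\<in>E. card e = 2)"

definition proper_colouring :: "'v set set \<Rightarrow> nat \<Rightarrow> ('v \<Rightarrow> nat) \<Rightarrow> bool" where
  "proper_colouring E c f \<longleftrightarrow> (\<forall>v. f v < c) \<and> (\<forall>u v. {u, v} \<in> E \<longrightarrow> f u \<noteq> f v)"

definition chromatic_number :: "'v set set \<Rightarrow> nat" where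
  "chromatic_number E = (LEAST c. \<exists>f. proper_colouring E c f)"

definition clique :: "'v set set \<Rightarrow> 'v set \<Rightarrow> bool" where
  "clique E C \<longleftrightarrow> (\<forall>u\<in>C. \<forall>v\<in>C. u \<noteq> v \<longrightarrow> {u, v} \<in> E)"

definition clique_number :: "('v::finite) set set \<Rightarrow> nat" where
  "clique_number E = Max {card C | C. clique E C}"

section \<open>Ideals and symbolic powers\<close>

text \<open>Ideals are the submodules of the ring regarded as a module over itself.\<close>

definition is_ideal :: "'a::comm_ring_1 set \<Rightarrow> bool" where
  "is_ideal I \<longleftrightarrow> module.subspace (*) I"

definition ideal_gen :: "'a::comm_ring_1 set \<Rightarrow> 'a set" where
  "ideal_gen S = module.span (*) S"

definition is_prime_ideal :: "'a::comm_ring_1 set \<Rightarrow> bool" where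
  "is_prime_ideal P \<longleftrightarrow>
     is_ideal P \<and> P \<noteq> UNIV \<and> (\<forall>a b. a * b \<in> P \<longrightarrow> a \<in> P \<or> b \<in> P)"

primrec ideal_power :: "'a::comm_ring_1 set \<Rightarrow> nat \<Rightarrow> 'a set" where
  "ideal_power J 0 = UNIV"
| "ideal_power J (Suc m) = ideal_gen {a * b | a b. a \<in> J \<and> b \<in> ideal_power J m}"

text \<open>
  As usual, the associated primes of an ideal \<open>J\<close> of \<open>R\<close> are those of the module \<open>R/J\<close>: the
  prime ideals that are the annihilator \<open>(J : f)\<close> of the class of some \<open>f\<close>.
\<close>

definition associated_primes :: "'a::comm_ring_1 set \<Rightarrow> 'a set set" where
  "associated_primes J = {P. is_prime_ideal P \<and> (\<exists>f. P = {r. r * f \<in> J})}"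

text \<open>
  The rings considered are domains, so the localization at a prime \<open>P\<close> is realized inside the
  fraction field, with \<open>a \<mapsto> Fract a 1\<close> as the embedding of \<open>R\<close>.
\<close>

definition localization :: "'a::idom set \<Rightarrow> 'a fract set" where
  "localization P = {Fract a s | a s. s \<notin> P}"

definition extended_ideal :: "'a::idom set \<Rightarrow> 'a set \<Rightarrow> 'a fract set" where
  "extended_ideal I P =
     {\<Sum>a\<in>A. r a * Fract a 1 | A r. finite A \<and> A \<subseteq> I \<and> r ` A \<subseteq> localization P}"

definition symbolic_power :: "'a::idom set \<Rightarrow> nat \<Rightarrow> 'a set" where
  "symbolic_power J m =
     (\<Inter>P\<in>associated_primes J. {f. Fract f 1 \<in> extended_ideal (ideal_power J m) P})"

section \<open>Polynomial rings, edge ideals, and the Waldschmidt constant\<close>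

text \<open>
  Polynomials over \<open>'k\<close> in variables indexed by \<open>'v\<close>: finitely supported maps from exponent
  vectors to coefficients, with the convolution product. The linear order on \<open>'v\<close> is there only
  because the library instance making this an integral domain asks for it.
\<close>

type_synonym ('v, 'k) mpoly = "('v \<Rightarrow>\<^sub>0 nat) \<Rightarrow>\<^sub>0 'k"

definition Var :: "'v \<Rightarrow> ('v, 'k::comm_ring_1) mpoly" where
  "Var v = Poly_Mapping.single (Poly_Mapping.single v 1) 1"

definition homogeneous :: "nat \<Rightarrow> ('v, 'k::zero) mpoly \<Rightarrow> bool" where
  "homogeneous d f \<longleftrightarrow>
     (\<forall>t\<in>Poly_Mapping.keys f. (\<Sum>v\<in>Poly_Mapping.keys t. Poly_Mapping.lookup t v) = d)"

text \<open>The least \<open>d\<close> with \<open>J\<^sub>d \<noteq> 0\<close>, where \<open>J\<^sub>d\<close> consists of the degree-\<open>d\<close> forms in \<open>J\<close>.\<close>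

definition initial_degree :: "('v, 'k::zero) mpoly set \<Rightarrow> nat" where
  "initial_degree J = (LEAST d. \<exists>f\<in>J. f \<noteq> 0 \<and> homogeneous d f)"

definition waldschmidt_constant :: "('v::linorder, 'k::field) mpoly set \<Rightarrow> real" where
  "waldschmidt_constant J = lim (\<lambda>m. real (initial_degree (symbolic_power J m)) / real m)"

definition edge_ideal :: "'v set set \<Rightarrow> ('v, 'k::comm_ring_1) mpoly set" where
  "edge_ideal E = ideal_gen {Var u * Var v | u v. {u, v} \<in> E}"

end

theory Submission
  imports Defs
begin

text \<open>
  The primes generated by minimal vertex covers are associated to the edge ideal, so every monomial
  of an element of the \<open>m\<close>-th symbolic power has degree at least \<open>m\<close> in the variables of any vertex
  cover. Summing over the complements of the \<open>\<chi>\<close> colour classes gives \<open>\<chi> m \<le> (\<chi> - 1) d\<close> for the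
  degree \<open>d\<close>. Conversely, the product of the variables of a clique of size \<open>\<omega>\<close> has degree \<open>\<omega>\<close> and
  lies in the symbolic power of exponent \<open>\<omega> - 1\<close>; its powers give the upper bound. The limit exists
  because the initial degrees are subadditive.
\<close>

section \<open>Subadditive sequences\<close>

text \<open>Fekete's lemma: the quotients tend to their infimum. Writing
  \<open>n = q * k + r\<close> with \<open>r < k\<close> compares \<open>a n / n\<close> with
  \<open>a k / k\<close> for a \<open>k\<close> whose quotient is close to that infimum.\<close>

lemma subadditive_convergent:
  fixes a :: "nat \<Rightarrow> real"
  assumes nonneg: "\<And>n. 0 \<le> a n" and sub: "\<And>m n. a (m + n) \<le> a m + a n"
  shows "convergent (\<lambda>n. a n / real n)"
proof -
  \<comment> \<open>Index 0 is left out: \<open>a 0 / 0\<close> is 0 by convention and would spoil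
    the infimum.\<close>
  define S where "S = (\<lambda>n. a n / real n) ` {1..}"
  define L where "L = Inf S"
  have ne: "S \<noteq> {}" by (auto simp: S_def)
  have bdd: "bdd_below S"
    by (rule bdd_belowI[of _ 0]) (auto simp: S_def nonneg)
  have lower: "L \<le> a n / real n" if "n \<ge> 1" for n
    unfolding L_def by (rule cInf_lower) (use that bdd in \<open>auto simp: S_def\<close>)
  have mult: "a (q * k + r) \<le> real q * a k + a r" for q k r
  proof (induction q)
    case (Suc q)
    have "a (Suc q * k + r) \<le> a k + a (q * k + r)"
      using sub[of k "q * k + r"] by (simp add: algebra_simps)
    with Suc show ?case by (simp add: algebra_simps)
  qed simp
  have "(\<lambda>n. a n / real n) \<longlonglongrightarrow> L"
  proof (rule LIMSEQ_I)
    fix e :: real assume e: "0 < e"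
    have "Inf S < L + e / 2" using e by (simp add: L_def)
    then obtain k where k: "k \<ge> 1" "a k / real k < L + e / 2"
      using cInf_lessD[OF ne] by (auto simp: S_def)
    \<comment> \<open>A uniform bound for the remainder term \<open>a (n mod k)\<close>, which
      division by a large \<open>n\<close> makes negligible.\<close>
    define M where "M = Max (a ` {..<k})"
    have M: "a r \<le> M" if "r < k" for r
      unfolding M_def using that by (intro Max_ge) auto
    have M0: "0 \<le> M" using M[of 0] nonneg[of 0] k by linarith
    obtain N :: nat where N: "2 * M / e < real N" using reals_Archimedean2 by blast
    have "norm (a n / real n - L) < e" if n: "n \<ge> max 1 N" for n
    proof -
      have n0: "0 < real n" using n by simp
      have "a n = a (n div k * k + n mod k)" by simp
      also have "\<dots> \<le> real (n div k) * a k + M"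
        using mult[of "n div k" k "n mod k"] M[of "n mod k"] k by simp
      also have "real (n div k) * a k \<le> real n / real k * a k"
        by (intro mult_right_mono nonneg of_nat_div_le_of_nat)
      finally have "a n \<le> real n * (a k / real k) + M" by (simp add: field_simps)
      then have "a n / real n \<le> a k / real k + M / real n"
        using n0 by (simp add: field_simps)
      moreover have "M / real n < e / 2"
      proof -
        have "2 * M / e < real n" using N n by linarith
        then show ?thesis using e n0 by (simp add: field_simps)
      qed
      ultimately have "a n / real n < L + e" using k(2) by linarith
      moreover have "L \<le> a n / real n" using lower n by simp
      ultimately show ?thesis by simp
    qed
    then show "\<exists>no. \<forall>n\<ge>no. norm (a n / real n - L) < e" by blast
  qed
  then show ?thesis by (rule convergentI)
qed

section \<open>Ideals and symbolic powers in a domain\<close>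

text \<open>Not an interpretation: its simp rule \<open>scale_scale\<close> would loop with \<open>mult.assoc\<close>.\<close>

lemma module_mult: "module ((*) :: 'a::comm_ring_1 \<Rightarrow> 'a \<Rightarrow> 'a)"
  by unfold_locales (auto simp: algebra_simps)

lemma is_ideal_ideal_gen: "is_ideal (ideal_gen S)"
  by (simp add: is_ideal_def ideal_gen_def module.subspace_span[OF module_mult])

lemma is_ideal_mult_left: "is_ideal I \<Longrightarrow> a \<in> I \<Longrightarrow> r * a \<in> I"
  unfolding is_ideal_def by (rule module.subspace_scale[OF module_mult])

lemma is_ideal_add: "is_ideal I \<Longrightarrow> a \<in> I \<Longrightarrow> b \<in> I \<Longrightarrow> a + b \<in> I"
  unfolding is_ideal_def by (rule module.subspace_add[OF module_mult])

lemma is_ideal_0: "is_ideal I \<Longrightarrow> 0 \<in> I"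
  unfolding is_ideal_def by (rule module.subspace_0[OF module_mult])

lemma is_ideal_sum: "is_ideal I \<Longrightarrow> (\<And>x. x \<in> A \<Longrightarrow> f x \<in> I) \<Longrightarrow> sum f A \<in> I"
  unfolding is_ideal_def by (rule module.subspace_sum[OF module_mult])

lemma ideal_gen_base: "a \<in> S \<Longrightarrow> a \<in> ideal_gen S"
  unfolding ideal_gen_def by (rule module.span_base[OF module_mult])

lemma ideal_gen_minimal: "S \<subseteq> I \<Longrightarrow> is_ideal I \<Longrightarrow> ideal_gen S \<subseteq> I"
  unfolding ideal_gen_def is_ideal_def by (rule module.span_minimal[OF module_mult])

lemma is_ideal_ideal_power: "is_ideal (ideal_power J m)"
  by (cases m) (simp_all add: is_ideal_ideal_gen, simp add: is_ideal_def module.subspace_UNIV[OF module_mult])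

lemma is_ideal_colon:
  assumes "is_ideal I"
  shows "is_ideal {r. r * f \<in> I}"
  unfolding is_ideal_def
proof (rule module.subspaceI[OF module_mult])
  show "0 \<in> {r. r * f \<in> I}" using is_ideal_0[OF assms] by simp
  show "x + y \<in> {r. r * f \<in> I}" if "x \<in> {r. r * f \<in> I}" "y \<in> {r. r * f \<in> I}" for x y
    using is_ideal_add[OF assms] that by (simp add: distrib_right)
  show "c * x \<in> {r. r * f \<in> I}" if "x \<in> {r. r * f \<in> I}" for c x
    using is_ideal_mult_left[OF assms, of "x * f" c] that by (simp add: mult.assoc)
qed

lemma is_prime_ideal_one:
  assumes "is_prime_ideal P"
  shows "1 \<notin> P"
proof
  assume "1 \<in> P"
  then have "r \<in> P" for r
    using is_ideal_mult_left[of P 1 r] assms by (simp add: is_prime_ideal_def)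
  then show False using assms by (auto simp: is_prime_ideal_def)
qed

lemma is_prime_ideal_prod:
  assumes P: "is_prime_ideal P" and "finite A" "\<And>x. x \<in> A \<Longrightarrow> f x \<notin> P"
  shows "prod f A \<notin> P"
  using assms(2,3)
proof (induction A rule: finite_induct)
  case empty
  show ?case using is_prime_ideal_one[OF P] by simp
next
  case (insert x A)
  then show ?case using P by (auto simp: is_prime_ideal_def)
qed

text \<open>Induction on \<open>m\<close>: the elements that multiply \<open>b\<close> into the
  target power form an ideal, so it is enough to treat generators.\<close>

lemma ideal_power_mult:
  assumes "a \<in> ideal_power J m" "b \<in> ideal_power J n"
  shows "a * b \<in> ideal_power J (m + n)"
  using assms(1)
proof (induction m arbitrary: a)
  case 0
  then show ?case using assms(2) is_ideal_mult_left[OF is_ideal_ideal_power] by simp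
next
  case (Suc m)
  let ?I = "ideal_power J (Suc m + n)"
  have "ideal_gen {x * y |x y. x \<in> J \<and> y \<in> ideal_power J m} \<subseteq> {r. r * b \<in> ?I}"
  proof (rule ideal_gen_minimal)
    show "is_ideal {r. r * b \<in> ?I}" by (intro is_ideal_colon is_ideal_ideal_power)
    show "{x * y |x y. x \<in> J \<and> y \<in> ideal_power J m} \<subseteq> {r. r * b \<in> ?I}"
    proof clarify
      fix x y assume "x \<in> J" "y \<in> ideal_power J m"
      then have "\<exists>u v. x * (y * b) = u * v \<and> u \<in> J \<and> v \<in> ideal_power J (m + n)"
        using Suc.IH by blast
      then show "x * y * b \<in> ?I" by (simp add: mult.assoc ideal_gen_base)
    qed
  qed
  then show ?case using Suc.prems by auto
qed

lemma ideal_power_1: "J \<subseteq> ideal_power J 1"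
proof
  fix a assume "a \<in> J"
  then have "\<exists>x y. a = x * y \<and> x \<in> J \<and> y \<in> ideal_power J 0"
    by (intro exI[of _ a] exI[of _ 1]) simp
  then show "a \<in> ideal_power J 1" by (simp add: ideal_gen_base)
qed

lemma prod_in_ideal_power:
  assumes "finite A" "\<And>x. x \<in> A \<Longrightarrow> f x \<in> J"
  shows "prod f A \<in> ideal_power J (card A)"
  using assms
proof (induction A rule: finite_induct)
  case (insert x A)
  then have "f x * prod f A \<in> ideal_power J (1 + card A)"
    by (intro ideal_power_mult subsetD[OF ideal_power_1]) auto
  then show ?case using insert.hyps by (simp del: ideal_power.simps)
qed simp

lemma power_in_ideal_power: "a \<in> J \<Longrightarrow> a ^ m \<in> ideal_power J m"
  using prod_in_ideal_power[of "{..<m}" "\<lambda>_. a" J] by simp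

text \<open>Denominators are cleared one summand at a time; since \<open>P\<close> is prime, their
  product stays outside \<open>P\<close>.\<close>

lemma extended_ideal_common_denominator:
  assumes P: "is_prime_ideal P" and I: "is_ideal I" and x: "x \<in> extended_ideal I P"
  shows "\<exists>b\<in>I. \<exists>s. s \<notin> P \<and> x = Fract b s"
proof -
  have P0: "0 \<in> P" using P is_ideal_0 by (auto simp: is_prime_ideal_def)
  obtain A r where A: "finite A" "A \<subseteq> I" "r ` A \<subseteq> localization P"
    and xA: "x = (\<Sum>a\<in>A. r a * Fract a 1)"
    using x by (auto simp: extended_ideal_def)
  have "\<exists>b\<in>I. \<exists>s. s \<notin> P \<and> (\<Sum>a\<in>A. r a * Fract a 1) = Fract b s"
    using A
  proof (induction A rule: finite_induct)
    case empty
    show ?case using is_ideal_0[OF I] is_prime_ideal_one[OF P]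
      by (intro bexI[of _ 0] exI[of _ 1]) (auto simp: Zero_fract_def)
  next
    case (insert a A)
    then obtain b s where b: "b \<in> I" "s \<notin> P" "(\<Sum>a\<in>A. r a * Fract a 1) = Fract b s" by auto
    obtain c t where c: "t \<notin> P" "r a = Fract c t"
      using insert.prems by (auto simp: localization_def)
    have ne: "s \<noteq> 0" "t \<noteq> 0" using P0 b c by auto
    have "(\<Sum>a\<in>insert a A. r a * Fract a 1) = Fract (c * a) t + Fract b s"
      using insert.hyps b c by simp
    also have "\<dots> = Fract (s * c * a + t * b) (t * s)"
      using ne by (simp add: algebra_simps)
    moreover have "s * c * a + t * b \<in> I"
      using insert.prems b by (intro is_ideal_add is_ideal_mult_left I) auto
    moreover have "t * s \<notin> P" using P b c by (auto simp: is_prime_ideal_def)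
    ultimately show ?case by metis
  qed
  then show ?thesis using xA by simp
qed

text \<open>Eliminates fractions: over a domain, cross-multiplying
  \<open>Fract f 1 = Fract b s\<close> leaves only a multiplier \<open>s\<close> outside
  \<open>P\<close>.\<close>

lemma Fract_in_extended_ideal_iff:
  assumes P: "is_prime_ideal P" and I: "is_ideal I"
  shows "Fract f 1 \<in> extended_ideal I P \<longleftrightarrow> (\<exists>s. s \<notin> P \<and> s * f \<in> I)"
proof
  have P0: "0 \<in> P" using P is_ideal_0 by (auto simp: is_prime_ideal_def)
  {
    assume "Fract f 1 \<in> extended_ideal I P"
    then obtain b s where b: "b \<in> I" "s \<notin> P" "Fract f 1 = Fract b s"
      using extended_ideal_common_denominator[OF P I] by blast
    then have "s \<noteq> 0" using P0 by auto
    then have "s * f = b" using b(3) by (simp add: eq_fract mult.commute)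
    then show "\<exists>s. s \<notin> P \<and> s * f \<in> I" using b by auto
  }
  assume "\<exists>s. s \<notin> P \<and> s * f \<in> I"
  then obtain s where s: "s \<notin> P" "s * f \<in> I" by blast
  then have "s \<noteq> 0" using P0 by auto
  then have "Fract f 1 = (\<Sum>a\<in>{s * f}. Fract 1 s * Fract a 1)"
    by (simp add: eq_fract)
  moreover have "Fract 1 s \<in> localization P" using s by (auto simp: localization_def)
  ultimately show "Fract f 1 \<in> extended_ideal I P"
    unfolding extended_ideal_def using s
    by (intro CollectI exI[of _ "{s * f}"] exI[of _ "\<lambda>_. Fract 1 s"]) auto
qed

lemma symbolic_power_iff:
  "f \<in> symbolic_power J m \<longleftrightarrow> (\<forall>P\<in>associated_primes J. \<exists>s. s \<notin> P \<and> s * f \<in> ideal_power J m)"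
proof -
  have "is_prime_ideal P" if "P \<in> associated_primes J" for P
    using that by (simp add: associated_primes_def)
  then show ?thesis
    by (simp add: symbolic_power_def Fract_in_extended_ideal_iff is_ideal_ideal_power)
qed

text \<open>Multipliers for the two factors are multiplied; primality keeps the product outside
  \<open>P\<close>. This is the source of subadditivity of the initial degrees.\<close>

lemma symbolic_power_mult:
  assumes "f \<in> symbolic_power J m" "g \<in> symbolic_power J n"
  shows "f * g \<in> symbolic_power J (m + n)"
  unfolding symbolic_power_iff
proof
  fix P assume P: "P \<in> associated_primes J"
  obtain s t where s: "s \<notin> P" "s * f \<in> ideal_power J m"
    and t: "t \<notin> P" "t * g \<in> ideal_power J n"
    using assms P unfolding symbolic_power_iff by meson
  have "s * t \<notin> P" using P s t by (auto simp: associated_primes_def is_prime_ideal_def)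
  moreover have "s * t * (f * g) = s * f * (t * g)" by (simp add: algebra_simps)
  ultimately show "\<exists>s. s \<notin> P \<and> s * (f * g) \<in> ideal_power J (m + n)"
    using ideal_power_mult[OF s(2) t(2)] by metis
qed

lemma symbolic_power_power: "f \<in> symbolic_power J m \<Longrightarrow> f ^ j \<in> symbolic_power J (m * j)"
proof (induction j)
  case 0
  show ?case
    unfolding symbolic_power_iff associated_primes_def
    by (intro ballI exI[of _ 1]) (auto simp: is_prime_ideal_one)
next
  case (Suc j)
  then show ?case using symbolic_power_mult[of f J m "f ^ j" "m * j"] by simp
qed

lemma ideal_power_subset_symbolic_power: "ideal_power J m \<subseteq> symbolic_power J m"
  by (intro subsetI, unfold symbolic_power_iff associated_primes_def, intro ballI exI[of _ 1])
     (auto simp: is_prime_ideal_one)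

section \<open>Partial degrees of polynomials\<close>

text \<open>With \<open>C = UNIV\<close> this is the total degree, so homogeneity and the bounds
  coming from vertex covers share the same rules.\<close>

definition partial_degree :: "'v set \<Rightarrow> ('v \<Rightarrow>\<^sub>0 nat) \<Rightarrow> nat" where
  "partial_degree C t = (\<Sum>v\<in>C. Poly_Mapping.lookup t v)"

lemma partial_degree_add: "partial_degree C (s + t) = partial_degree C s + partial_degree C t"
  by (simp add: partial_degree_def lookup_add sum.distrib)

lemma partial_degree_single:
  "finite C \<Longrightarrow> partial_degree C (Poly_Mapping.single v n) = (if v \<in> C then n else 0)"
  by (simp add: partial_degree_def lookup_single when_def)

lemma partial_degree_mono: "finite D \<Longrightarrow> C \<subseteq> D \<Longrightarrow> partial_degree C t \<le> partial_degree D t"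
  unfolding partial_degree_def by (rule sum_mono2) auto

lemma homogeneous_iff:
  fixes f :: "('v::finite, 'k::zero) mpoly"
  shows "homogeneous d f \<longleftrightarrow> (\<forall>t\<in>Poly_Mapping.keys f. partial_degree UNIV t = d)"
proof -
  have "partial_degree UNIV t = (\<Sum>v\<in>Poly_Mapping.keys t. Poly_Mapping.lookup t v)"
    for t :: "'v \<Rightarrow>\<^sub>0 nat"
    unfolding partial_degree_def by (rule sum.mono_neutral_right) (auto simp: in_keys_iff)
  then show ?thesis by (simp add: homogeneous_def)
qed

lemma keys_mult_cases:
  assumes "t \<in> Poly_Mapping.keys (f * g)"
  obtains a b where "a \<in> Poly_Mapping.keys f" "b \<in> Poly_Mapping.keys g" "t = a + b"
  using assms keys_mult[of f g] by blast

lemma homogeneous_mult: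
  fixes f g :: "('v::finite, 'k::comm_ring_1) mpoly"
  assumes "homogeneous c f" "homogeneous d g"
  shows "homogeneous (c + d) (f * g)"
  using assms unfolding homogeneous_iff
  by (auto elim!: keys_mult_cases simp: partial_degree_add)

lemma homogeneous_power:
  fixes f :: "('v::finite, 'k::comm_ring_1) mpoly"
  shows "homogeneous d f \<Longrightarrow> homogeneous (d * j) (f ^ j)"
proof (induction j)
  case 0
  show ?case by (simp add: homogeneous_iff partial_degree_def)
next
  case (Suc j)
  then show ?case using homogeneous_mult[of d f "d * j" "f ^ j"] by simp
qed

lemma homogeneous_Var: "homogeneous 1 (Var v :: ('v::finite, 'k::comm_ring_1) mpoly)"
  by (simp add: homogeneous_iff Var_def partial_degree_single)

lemma homogeneous_prod_Var:
  fixes A :: "'v::finite set"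
  shows "homogeneous (card A) (\<Prod>v\<in>A. Var v :: ('v, 'k::comm_ring_1) mpoly)"
proof (induction A rule: finite_induct[OF finite])
  case 1
  show ?case by (simp add: homogeneous_iff partial_degree_def)
next
  case (2 v A)
  then show ?case using homogeneous_mult[OF homogeneous_Var[of v]] by auto
qed

lemma Var_neq_0: "(Var v :: ('v, 'k::comm_ring_1) mpoly) \<noteq> 0"
proof
  assume "(Var v :: ('v, 'k) mpoly) = 0"
  then have "Poly_Mapping.lookup (Var v :: ('v, 'k) mpoly) (Poly_Mapping.single v 1) = 0" by simp
  then show False by (simp add: Var_def)
qed

lemma poly_mapping_eq_sum_single:
  "f = (\<Sum>t\<in>Poly_Mapping.keys f. Poly_Mapping.single t (Poly_Mapping.lookup f t))"
  by (rule poly_mapping_eqI) (auto simp: lookup_sum lookup_single when_def in_keys_iff)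

text \<open>Multiplication by one term shifts exponent vectors injectively, so no two coefficients
  merge.\<close>

lemma lookup_mult_single_add:
  fixes f :: "('v, 'k::comm_ring_1) mpoly"
  shows "Poly_Mapping.lookup (f * Poly_Mapping.single s c) (t + s) = Poly_Mapping.lookup f t * c"
proof -
  have "f * Poly_Mapping.single s c =
      (\<Sum>r\<in>Poly_Mapping.keys f. Poly_Mapping.single r (Poly_Mapping.lookup f r)) * Poly_Mapping.single s c"
    using poly_mapping_eq_sum_single[of f] by simp
  also have "\<dots> = (\<Sum>r\<in>Poly_Mapping.keys f. Poly_Mapping.single (r + s) (Poly_Mapping.lookup f r * c))"
    by (simp add: sum_distrib_right mult_single)
  finally show ?thesis by (auto simp: lookup_sum lookup_single when_def in_keys_iff)
qed

text \<open>The lowest forms of two polynomials cannot cancel in the product, so the order of vanishing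
  along the coordinate subspace of \<open>C\<close> is a valuation.\<close>

lemma keys_mult_lowest:
  fixes f g :: "('v::linorder, 'k::idom) mpoly"
  assumes f: "a \<in> Poly_Mapping.keys f" and g: "b \<in> Poly_Mapping.keys g"
    and fmin: "\<And>t. t \<in> Poly_Mapping.keys f \<Longrightarrow> partial_degree C a \<le> partial_degree C t"
    and gmin: "\<And>t. t \<in> Poly_Mapping.keys g \<Longrightarrow> partial_degree C b \<le> partial_degree C t"
  shows "\<exists>t\<in>Poly_Mapping.keys (f * g). partial_degree C t = partial_degree C a + partial_degree C b"
proof -
  \<comment> \<open>\<open>low p n\<close> is the component of \<open>p\<close> in
    \<open>C\<close>-degree \<open>n\<close>; \<open>fl\<close> and \<open>gl\<close> below are the
    lowest forms of \<open>f\<close> and \<open>g\<close>.\<close>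
  define low where "low p n = (\<Sum>t\<in>{t\<in>Poly_Mapping.keys p. partial_degree C t = n}.
      Poly_Mapping.single t (Poly_Mapping.lookup p t))" for p :: "('v, 'k) mpoly" and n
  have lookup_low: "Poly_Mapping.lookup (low p n) t =
      (if partial_degree C t = n then Poly_Mapping.lookup p t else 0)" for p n t
    by (auto simp: low_def lookup_sum lookup_single when_def in_keys_iff)
  let ?m = "partial_degree C a" and ?n = "partial_degree C b"
  define fl gl where "fl = low f ?m" and "gl = low g ?n"
  have "Poly_Mapping.lookup fl a \<noteq> 0" "Poly_Mapping.lookup gl b \<noteq> 0"
    using f g by (auto simp: fl_def gl_def lookup_low in_keys_iff)
  then have "fl * gl \<noteq> 0" by auto
  then obtain t where t: "t \<in> Poly_Mapping.keys (fl * gl)"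
    by (metis keys_eq_empty ex_in_conv)
  have kfl: "partial_degree C s = ?m" if "s \<in> Poly_Mapping.keys fl" for s
    using that by (auto simp: fl_def lookup_low in_keys_iff split: if_splits)
  have kgl: "partial_degree C s = ?n" if "s \<in> Poly_Mapping.keys gl" for s
    using that by (auto simp: gl_def lookup_low in_keys_iff split: if_splits)
  have kfh: "partial_degree C s > ?m" if "s \<in> Poly_Mapping.keys (f - fl)" for s
    using that fmin[of s]
    by (auto simp: fl_def lookup_low lookup_minus in_keys_iff split: if_splits)
  have kgh: "partial_degree C s > ?n" if "s \<in> Poly_Mapping.keys (g - gl)" for s
    using that gmin[of s]
    by (auto simp: gl_def lookup_low lookup_minus in_keys_iff split: if_splits)
  have deg: "partial_degree C t = ?m + ?n"
    using t kfl kgl by (auto elim!: keys_mult_cases simp: partial_degree_add)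
  have 1: "t \<notin> Poly_Mapping.keys (fl * (g - gl))"
    using deg kfl kgh by (force elim!: keys_mult_cases simp: partial_degree_add)
  have 2: "t \<notin> Poly_Mapping.keys ((f - fl) * g)"
    using deg kfh gmin by (force elim!: keys_mult_cases simp: partial_degree_add)
  \<comment> \<open>The last two products have terms only in \<open>C\<close>-degree above that of
    \<open>t\<close>, so they do not affect the coefficient there.\<close>
  have "f * g = fl * gl + (fl * (g - gl) + (f - fl) * g)" by (simp add: algebra_simps)
  then have "Poly_Mapping.lookup (f * g) t = Poly_Mapping.lookup (fl * gl) t
      + (Poly_Mapping.lookup (fl * (g - gl)) t + Poly_Mapping.lookup ((f - fl) * g) t)"
    by (simp only: lookup_add)
  also have "\<dots> \<noteq> 0" using t 1 2 by (simp add: in_keys_iff)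
  finally show ?thesis using deg by (auto simp: in_keys_iff)
qed

lemma exists_lowest_key:
  assumes "f \<noteq> 0"
  obtains a where "a \<in> Poly_Mapping.keys f"
    "\<And>t. t \<in> Poly_Mapping.keys f \<Longrightarrow> partial_degree C a \<le> partial_degree C t"
proof -
  have "Poly_Mapping.keys f \<noteq> {}" using assms by (simp add: poly_mapping_eq_iff keys_def fun_eq_iff)
  then show ?thesis
    using that arg_min_if_finite(1)[OF finite_keys] arg_min_least[OF finite_keys] by metis
qed

section \<open>Initial degrees\<close>

lemma initial_degree_le:
  "f \<in> J \<Longrightarrow> f \<noteq> 0 \<Longrightarrow> homogeneous d f \<Longrightarrow> initial_degree J \<le> d"
  unfolding initial_degree_def by (rule Least_le) blast

lemma initial_degree_attained:
  assumes "f \<in> J" "f \<noteq> 0" "homogeneous d f"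
  obtains g where "g \<in> J" "g \<noteq> 0" "homogeneous (initial_degree J) g"
proof -
  have "\<exists>g\<in>J. g \<noteq> 0 \<and> homogeneous (initial_degree J) g"
    unfolding initial_degree_def by (rule LeastI_ex) (use assms in blast)
  then show ?thesis using that by blast
qed

text \<open>The convergence clause matters because \<open>lim\<close> is arbitrary on divergent sequences.\<close>

lemma waldschmidt_constant_tendsto:
  fixes J :: "('v::{finite, linorder}, 'k::field) mpoly set"
  assumes J: "f \<in> J" "f \<noteq> 0" "homogeneous d f"
  shows "(\<lambda>m. real (initial_degree (symbolic_power J m)) / real m) \<longlonglongrightarrow> waldschmidt_constant J"
proof -
  let ?a = "\<lambda>m. initial_degree (symbolic_power J m)"
  \<comment> \<open>Powers of \<open>f\<close> are nonzero forms in the symbolic powers, so each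
    \<open>LEAST\<close> is attained.\<close>
  have ex: "\<exists>g\<in>symbolic_power J m. g \<noteq> 0 \<and> homogeneous (?a m) g" for m
  proof -
    have "f ^ m \<in> symbolic_power J m"
      using power_in_ideal_power[OF J(1)] ideal_power_subset_symbolic_power by blast
    moreover have "f ^ m \<noteq> 0" using J(2) by simp
    ultimately show ?thesis
      using initial_degree_attained[OF _ _ homogeneous_power[OF J(3)]] by metis
  qed
  have "?a (m + n) \<le> ?a m + ?a n" for m n
  proof -
    obtain g h where "g \<in> symbolic_power J m" "g \<noteq> 0" "homogeneous (?a m) g"
      "h \<in> symbolic_power J n" "h \<noteq> 0" "homogeneous (?a n) h"
      using ex[of m] ex[of n] by blast
    then show ?thesis
      by (intro initial_degree_le[of "g * h"] symbolic_power_mult homogeneous_mult) auto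
  qed
  then have "convergent (\<lambda>m. real (?a m) / real m)"
    by (intro subadditive_convergent) (simp_all flip: of_nat_add)
  then show ?thesis unfolding waldschmidt_constant_def by (simp add: convergent_LIMSEQ_iff)
qed

section \<open>Edge ideals\<close>

lemma Var_mult_Var: "Var u * Var v = Poly_Mapping.single (Poly_Mapping.single u 1 + Poly_Mapping.single v 1) 1"
  by (simp add: Var_def mult_single)

text \<open>Divisibility of a monomial by a generator of the edge ideal, provided that the ends of
  every edge are distinct.\<close>

definition covers_edge :: "'v set set \<Rightarrow> ('v \<Rightarrow>\<^sub>0 nat) \<Rightarrow> bool" where
  "covers_edge E t \<longleftrightarrow>
     (\<exists>u v. {u, v} \<in> E \<and> Poly_Mapping.lookup t u \<noteq> 0 \<and> Poly_Mapping.lookup t v \<noteq> 0)"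

lemma covers_edge_add: "covers_edge E t \<Longrightarrow> covers_edge E (s + t)"
  by (auto simp: covers_edge_def lookup_add)

text \<open>The common source of the monomial ideals below: the edge ideal, the primes of vertex
  covers, and the ideals cut out by a lower bound on a partial degree.\<close>

lemma is_ideal_of_keys:
  fixes Q :: "('v \<Rightarrow>\<^sub>0 nat) \<Rightarrow> bool"
  assumes "\<And>s t. Q t \<Longrightarrow> Q (s + t)"
  shows "is_ideal {f :: ('v, 'k::comm_ring_1) mpoly. \<forall>t\<in>Poly_Mapping.keys f. Q t}"
  unfolding is_ideal_def
proof (rule module.subspaceI[OF module_mult]; clarsimp)
  show "Q t" if "\<forall>t\<in>Poly_Mapping.keys f. Q t" "\<forall>t\<in>Poly_Mapping.keys g. Q t"
    "t \<in> Poly_Mapping.keys (f + g)" for f g :: "('v, 'k) mpoly" and t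
    using that Poly_Mapping.keys_add[of f g] by blast
  show "Q t" if "\<forall>t\<in>Poly_Mapping.keys f. Q t" "t \<in> Poly_Mapping.keys (c * f)"
    for c f :: "('v, 'k) mpoly" and t
    using that assms by (auto elim!: keys_mult_cases)
qed

text \<open>Membership in a monomial ideal is decided term by term: the right-hand side defines an
  ideal containing the generators, and conversely each term of \<open>f\<close> is a multiple of a
  generator.\<close>

lemma edge_ideal_iff:
  fixes f :: "('v, 'k::comm_ring_1) mpoly"
  assumes E: "simple_graph E"
  shows "f \<in> edge_ideal E \<longleftrightarrow> (\<forall>t\<in>Poly_Mapping.keys f. covers_edge E t)"
proof
  let ?S = "{Var u * Var v |u v. {u, v} \<in> E} :: ('v, 'k) mpoly set"
  have "edge_ideal E \<subseteq> {f :: ('v, 'k) mpoly. \<forall>t\<in>Poly_Mapping.keys f. covers_edge E t}"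
    unfolding edge_ideal_def
  proof (rule ideal_gen_minimal)
    show "?S \<subseteq> {f. \<forall>t\<in>Poly_Mapping.keys f. covers_edge E t}"
    proof clarify
      fix u v :: 'v and t
      assume uv: "{u, v} \<in> E" and t: "t \<in> Poly_Mapping.keys (Var u * Var v :: ('v, 'k) mpoly)"
      have "t = Poly_Mapping.single u 1 + Poly_Mapping.single v 1"
        using t by (simp add: Var_mult_Var)
      then show "covers_edge E t"
        unfolding covers_edge_def using uv
        by (intro exI[of _ u] exI[of _ v]) (simp add: lookup_add)
    qed
    show "is_ideal {f :: ('v, 'k) mpoly. \<forall>t\<in>Poly_Mapping.keys f. covers_edge E t}"
      by (rule is_ideal_of_keys) (rule covers_edge_add)
  qed
  then show "\<forall>t\<in>Poly_Mapping.keys f. covers_edge E t" if "f \<in> edge_ideal E" using that by blast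
  assume f: "\<forall>t\<in>Poly_Mapping.keys f. covers_edge E t"
  have "Poly_Mapping.single t c \<in> edge_ideal E" if "covers_edge E t" for t and c :: 'k
  proof -
    obtain u v where uv: "{u, v} \<in> E" "Poly_Mapping.lookup t u \<noteq> 0" "Poly_Mapping.lookup t v \<noteq> 0"
      using \<open>covers_edge E t\<close> by (auto simp: covers_edge_def)
    have "card {u, v} = 2" using uv(1) E unfolding simple_graph_def by blast
    then have "u \<noteq> v" by auto
    let ?e = "Poly_Mapping.single u 1 + Poly_Mapping.single v 1 :: 'v \<Rightarrow>\<^sub>0 nat"
    \<comment> \<open>The truncated subtraction is exact because both exponents are positive and
      \<open>u \<noteq> v\<close>.\<close>
    have "t = (t - ?e) + ?e"
      using uv \<open>u \<noteq> v\<close>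
      by (intro poly_mapping_eqI) (auto simp: lookup_add lookup_minus lookup_single when_def)
    then have "Poly_Mapping.single t c = Poly_Mapping.single (t - ?e) c * (Var u * Var v)"
      unfolding Var_mult_Var by (simp add: mult_single)
    moreover have "Var u * Var v \<in> (edge_ideal E :: ('v, 'k) mpoly set)"
      unfolding edge_ideal_def using uv(1) by (intro ideal_gen_base) blast
    ultimately show ?thesis
      by (simp add: edge_ideal_def is_ideal_mult_left is_ideal_ideal_gen)
  qed
  then have "(\<Sum>t\<in>Poly_Mapping.keys f. Poly_Mapping.single t (Poly_Mapping.lookup f t)) \<in> edge_ideal E"
    using f by (intro is_ideal_sum) (auto simp: edge_ideal_def is_ideal_ideal_gen)
  then show "f \<in> edge_ideal E" using poly_mapping_eq_sum_single[of f] by simp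
qed

lemma Var_mult_Var_in_edge_ideal: "{u, v} \<in> E \<Longrightarrow> Var u * Var v \<in> edge_ideal E"
  unfolding edge_ideal_def by (intro ideal_gen_base) blast

lemma is_ideal_edge_ideal: "is_ideal (edge_ideal E)"
  by (simp add: edge_ideal_def is_ideal_ideal_gen)

section \<open>Vertex covers and associated primes of the edge ideal\<close>

definition vertex_cover :: "'v set set \<Rightarrow> 'v set \<Rightarrow> bool" where
  "vertex_cover E C \<longleftrightarrow> (\<forall>e\<in>E. e \<inter> C \<noteq> {})"

lemma exists_minimal_vertex_cover:
  fixes C :: "'v::finite set"
  assumes "vertex_cover E C"
  obtains D where "D \<subseteq> C" "vertex_cover E D"
    "\<And>v. v \<in> D \<Longrightarrow> \<not> vertex_cover E (D - {v})"
proof -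
  obtain D where D: "D \<subseteq> C" "vertex_cover E D"
    "\<And>D'. D' \<subseteq> D \<Longrightarrow> vertex_cover E D' \<Longrightarrow> D' = D"
    using finite_has_minimal2[of "Collect (vertex_cover E)" C] assms by auto
  then show ?thesis by (intro that[of D]) blast+
qed

lemma partial_degree_pos_iff:
  "finite C \<Longrightarrow> 0 < partial_degree C t \<longleftrightarrow> (\<exists>v\<in>C. Poly_Mapping.lookup t v \<noteq> 0)"
  by (auto simp: partial_degree_def sum_eq_0_iff simp flip: neq0_conv)

lemma covers_edge_partial_degree:
  assumes "finite C" "vertex_cover E C" "covers_edge E t"
  shows "1 \<le> partial_degree C t"
proof -
  have "0 < partial_degree C t"
    unfolding partial_degree_pos_iff[OF assms(1)]
    using assms(2,3) by (fastforce simp: vertex_cover_def covers_edge_def)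
  then show ?thesis by simp
qed

text \<open>The partial degree is additive, so every factor from \<open>J\<close> contributes at
  least 1; sums and multiples preserve the bound.\<close>

lemma ideal_power_partial_degree:
  fixes J :: "('v, 'k::comm_ring_1) mpoly set"
  assumes J: "\<And>f t. f \<in> J \<Longrightarrow> t \<in> Poly_Mapping.keys f \<Longrightarrow> 1 \<le> partial_degree C t"
    and "f \<in> ideal_power J m" "t \<in> Poly_Mapping.keys f"
  shows "m \<le> partial_degree C t"
  using assms(2,3)
proof (induction m arbitrary: f t)
  case (Suc m)
  let ?K = "{f :: ('v, 'k) mpoly. \<forall>t\<in>Poly_Mapping.keys f. Suc m \<le> partial_degree C t}"
  have "ideal_power J (Suc m) \<subseteq> ?K"
    unfolding ideal_power.simps
  proof (rule ideal_gen_minimal)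
    show "is_ideal ?K" by (rule is_ideal_of_keys) (simp add: partial_degree_add)
    show "{a * b |a b. a \<in> J \<and> b \<in> ideal_power J m} \<subseteq> ?K"
    proof clarify
      fix a b :: "('v, 'k) mpoly" and t
      assume ab: "a \<in> J" "b \<in> ideal_power J m" "t \<in> Poly_Mapping.keys (a * b)"
      then obtain r s where rs: "r \<in> Poly_Mapping.keys a" "s \<in> Poly_Mapping.keys b" "t = r + s"
        by (auto elim!: keys_mult_cases)
      then have "1 \<le> partial_degree C r" "m \<le> partial_degree C s"
        using J ab Suc.IH by auto
      then show "Suc m \<le> partial_degree C t" by (simp add: rs(3) partial_degree_add)
    qed
  qed
  then show ?case using Suc.prems by blast
qed simp

text \<open>For finite \<open>C\<close> this is the ideal generated by the variables in
  \<open>C\<close>. Two polynomials outside it have terms of \<open>C\<close>-degree 0, hence so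
  does their product.\<close>

lemma is_prime_ideal_variables:
  fixes C :: "'v::linorder set"
  shows "is_prime_ideal {f :: ('v, 'k::idom) mpoly. \<forall>t\<in>Poly_Mapping.keys f. 0 < partial_degree C t}"
    (is "is_prime_ideal ?P")
  unfolding is_prime_ideal_def
proof (intro conjI allI impI)
  show "is_ideal ?P" by (rule is_ideal_of_keys) (simp add: partial_degree_add)
  have "(1 :: ('v, 'k) mpoly) \<notin> ?P" by (simp add: partial_degree_def)
  then show "?P \<noteq> UNIV" by blast
  fix a b :: "('v, 'k) mpoly"
  assume ab: "a * b \<in> ?P"
  show "a \<in> ?P \<or> b \<in> ?P"
  proof (rule ccontr)
    assume "\<not> ?thesis"
    then obtain s t where s: "s \<in> Poly_Mapping.keys a" "partial_degree C s = 0"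
      and t: "t \<in> Poly_Mapping.keys b" "partial_degree C t = 0"
      by auto
    have "\<exists>r\<in>Poly_Mapping.keys (a * b). partial_degree C r = 0"
      using keys_mult_lowest[OF s(1) t(1), of C] s(2) t(2) by simp
    then show False using ab by auto
  qed
qed

text \<open>The prime generated by the variables in a minimal vertex cover \<open>C\<close> is the annihilator of
  the product of the variables outside \<open>C\<close>.\<close>

lemma minimal_vertex_cover_associated_prime:
  fixes C :: "'v::{finite, linorder} set"
  assumes E: "simple_graph E" and C: "vertex_cover E C"
    and minimal: "\<And>v. v \<in> C \<Longrightarrow> \<not> vertex_cover E (C - {v})"
  shows "{f :: ('v, 'k::idom) mpoly. \<forall>t\<in>Poly_Mapping.keys f. 0 < partial_degree C t}
    \<in> associated_primes (edge_ideal E)"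
proof -
  let ?P = "{f :: ('v, 'k) mpoly. \<forall>t\<in>Poly_Mapping.keys f. 0 < partial_degree C t}"
  define c :: "'v \<Rightarrow>\<^sub>0 nat" where "c = (\<Sum>v\<in>-C. Poly_Mapping.single v 1)"
  have lookup_c: "Poly_Mapping.lookup c v = (if v \<in> C then 0 else 1)" for v
    by (simp add: c_def lookup_sum lookup_single when_def)
  have cov: "covers_edge E (t + c) \<longleftrightarrow> 0 < partial_degree C t" for t
  proof
    assume "covers_edge E (t + c)"
    then obtain u v where uv: "{u, v} \<in> E" "Poly_Mapping.lookup (t + c) u \<noteq> 0"
      "Poly_Mapping.lookup (t + c) v \<noteq> 0" by (auto simp: covers_edge_def)
    moreover have "u \<in> C \<or> v \<in> C" using C uv(1) by (force simp: vertex_cover_def)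
    ultimately show "0 < partial_degree C t"
      by (auto simp: partial_degree_pos_iff lookup_add lookup_c)
  next
    assume "0 < partial_degree C t"
    then obtain v where v: "v \<in> C" "Poly_Mapping.lookup t v \<noteq> 0"
      by (auto simp: partial_degree_pos_iff)
    \<comment> \<open>Minimality supplies an edge that meets \<open>C\<close> only in
      \<open>v\<close>; its other end \<open>w\<close> lies outside \<open>C\<close> and therefore
      has exponent 1 in \<open>c\<close>.\<close>
    obtain e where e: "e \<in> E" "e \<inter> (C - {v}) = {}"
      using minimal[OF v(1)] by (auto simp: vertex_cover_def)
    then have "v \<in> e" using C unfolding vertex_cover_def by blast
    moreover have "card e = 2" using e E by (simp add: simple_graph_def)
    then obtain a b where "e = {a, b}" "a \<noteq> b" by (auto simp: card_2_iff)
    ultimately obtain w where w: "e = {v, w}" "w \<noteq> v" by blast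
    then have "w \<notin> C" using e by auto
    then show "covers_edge E (t + c)"
      unfolding covers_edge_def using e(1) w(1) v
      by (intro exI[of _ v] exI[of _ w]) (simp add: lookup_add lookup_c)
  qed
  let ?x = "Poly_Mapping.single c 1 :: ('v, 'k) mpoly"
  have keys: "Poly_Mapping.keys (r * ?x) = (\<lambda>t. t + c) ` Poly_Mapping.keys r" for r :: "('v, 'k) mpoly"
  proof
    show "Poly_Mapping.keys (r * ?x) \<subseteq> (\<lambda>t. t + c) ` Poly_Mapping.keys r"
      using keys_mult[of r ?x] by auto
    show "(\<lambda>t. t + c) ` Poly_Mapping.keys r \<subseteq> Poly_Mapping.keys (r * ?x)"
      using lookup_mult_single_add[of r c 1] by (auto simp: in_keys_iff)
  qed
  have "?P = {r. r * ?x \<in> edge_ideal E}"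
    by (auto simp: edge_ideal_iff[OF E] keys cov)
  then show ?thesis
    unfolding associated_primes_def using is_prime_ideal_variables by blast
qed

text \<open>Let \<open>D\<close> be a minimal cover inside \<open>C\<close>. A multiplier outside
  the prime of \<open>D\<close> has a term of \<open>D\<close>-degree 0, so multiplying by it keeps
  the lowest \<open>D\<close>-degree of \<open>f\<close>, while the product lies in the ordinary
  power.\<close>

lemma symbolic_power_partial_degree:
  fixes f :: "('v::{finite, linorder}, 'k::idom) mpoly"
  assumes E: "simple_graph E" and C: "vertex_cover E C"
    and f: "f \<in> symbolic_power (edge_ideal E) m" and t: "t \<in> Poly_Mapping.keys f"
  shows "m \<le> partial_degree C t"
proof -
  obtain D where D: "D \<subseteq> C" "vertex_cover E D" "\<And>v. v \<in> D \<Longrightarrow> \<not> vertex_cover E (D - {v})"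
    using exists_minimal_vertex_cover[OF C] by blast
  obtain s where s: "\<exists>r\<in>Poly_Mapping.keys s. partial_degree D r = 0"
      "s * f \<in> ideal_power (edge_ideal E) m"
    using f minimal_vertex_cover_associated_prime[OF E D(2,3), where 'k='k]
    by (fastforce simp: symbolic_power_iff)
  from s(1) obtain r where r: "r \<in> Poly_Mapping.keys s" "partial_degree D r = 0" by blast
  have "f \<noteq> 0" using t by auto
  then obtain a where a: "a \<in> Poly_Mapping.keys f"
    "\<And>t. t \<in> Poly_Mapping.keys f \<Longrightarrow> partial_degree D a \<le> partial_degree D t"
    using exists_lowest_key by blast
  obtain b where b: "b \<in> Poly_Mapping.keys (s * f)" "partial_degree D b = partial_degree D a"
    using keys_mult_lowest[of r s a f D] r a by auto
  have "m \<le> partial_degree D b"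
  proof (rule ideal_power_partial_degree[OF _ s(2) b(1)])
    show "1 \<le> partial_degree D t" if "f \<in> edge_ideal E" "t \<in> Poly_Mapping.keys f"
      for f :: "('v, 'k) mpoly" and t
      using that covers_edge_partial_degree[OF _ D(2)] by (auto simp: edge_ideal_iff[OF E])
  qed
  also have "\<dots> \<le> partial_degree D t" using a t b by simp
  also have "\<dots> \<le> partial_degree C t" using D(1) by (intro partial_degree_mono) auto
  finally show ?thesis .
qed

section \<open>The lower bound from colourings\<close>

text \<open>Complements of colour classes are vertex covers, and each vertex lies in all but one of them.\<close>

lemma colouring_degree_bound:
  fixes f :: "('v::{finite, linorder}, 'k::idom) mpoly"
  assumes E: "simple_graph E" and col: "proper_colouring E c h"
    and f: "f \<in> symbolic_power (edge_ideal E) m" "f \<noteq> 0" "homogeneous d f"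
  shows "c * m \<le> (c - 1) * d"
proof -
  obtain t where t: "t \<in> Poly_Mapping.keys f"
    using exists_lowest_key[OF f(2)] by blast
  have cover: "vertex_cover E {v. h v \<noteq> i}" for i
    unfolding vertex_cover_def
  proof
    fix e assume e: "e \<in> E"
    then have "card e = 2" using E by (simp add: simple_graph_def)
    then obtain u v where "e = {u, v}" by (auto simp: card_2_iff)
    moreover from this have "h u \<noteq> h v" using col e by (simp add: proper_colouring_def)
    ultimately show "e \<inter> {v. h v \<noteq> i} \<noteq> {}" by auto
  qed
  have "c * m = (\<Sum>i<c. m)" by simp
  also have "\<dots> \<le> (\<Sum>i<c. partial_degree {v. h v \<noteq> i} t)"
    by (intro sum_mono symbolic_power_partial_degree[OF E cover f(1) t])
  also have "\<dots> = (\<Sum>i<c. \<Sum>v\<in>UNIV. if h v \<noteq> i then Poly_Mapping.lookup t v else 0)"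
    unfolding partial_degree_def by (intro sum.cong refl sum.mono_neutral_cong_left) auto
  also have "\<dots> = (\<Sum>v\<in>UNIV. \<Sum>i<c. if h v \<noteq> i then Poly_Mapping.lookup t v else 0)"
    by (rule sum.swap)
  also have "\<dots> = (\<Sum>v\<in>UNIV. (c - 1) * Poly_Mapping.lookup t v)"
  proof (intro sum.cong refl)
    fix v
    have "h v \<in> {..<c}" using col by (simp add: proper_colouring_def)
    then show "(\<Sum>i<c. if h v \<noteq> i then Poly_Mapping.lookup t v else 0) = (c - 1) * Poly_Mapping.lookup t v"
      by (simp add: sum.remove)
  qed
  also have "\<dots> = (c - 1) * d"
    using f(3) t by (simp add: homogeneous_iff partial_degree_def flip: sum_distrib_left)
  finally show ?thesis .
qed

section \<open>The upper bound from cliques\<close>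

text \<open>Write \<open>P\<close> as the annihilator of \<open>f\<close> and take a monomial
  \<open>t\<close> of \<open>f\<close> outside the edge ideal. Since \<open>Var u\<close> times
  \<open>t\<close> lies inside, some neighbour \<open>w\<close> of \<open>u\<close> divides
  \<open>t\<close>. Multiplying \<open>t\<close> by \<open>Var w\<close> leaves its support
  unchanged, hence \<open>Var w \<notin> P\<close>.\<close>

lemma associated_prime_neighbour:
  fixes P :: "('v, 'k::comm_ring_1) mpoly set"
  assumes E: "simple_graph E" and P: "P \<in> associated_primes (edge_ideal E)" and u: "Var u \<in> P"
  shows "\<exists>w. {u, w} \<in> E \<and> Var w \<notin> P"
proof -
  obtain f where Pf: "P = {r. r * f \<in> edge_ideal E}" and prime: "is_prime_ideal P"
    using P by (auto simp: associated_primes_def)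
  have "f \<notin> edge_ideal E" using is_prime_ideal_one[OF prime] by (simp add: Pf)
  then obtain t where t: "t \<in> Poly_Mapping.keys f" "\<not> covers_edge E t"
    by (auto simp: edge_ideal_iff[OF E])
  have shift: "covers_edge E (Poly_Mapping.single w 1 + t)" if "Var w \<in> P" for w
  proof -
    have "Poly_Mapping.lookup (Var w * f) (Poly_Mapping.single w 1 + t) = Poly_Mapping.lookup f t"
      using lookup_mult_single_add[of f "Poly_Mapping.single w 1" 1 t]
      by (simp add: Var_def ac_simps)
    then show ?thesis
      using that t(1) by (auto simp: Pf edge_ideal_iff[OF E] in_keys_iff)
  qed
  obtain a b where ab: "{a, b} \<in> E" "Poly_Mapping.lookup (Poly_Mapping.single u 1 + t) a \<noteq> 0"
    "Poly_Mapping.lookup (Poly_Mapping.single u 1 + t) b \<noteq> 0"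
    using shift[OF u] by (auto simp: covers_edge_def)
  have "card {a, b} = 2" using ab(1) E unfolding simple_graph_def by blast
  then have "a \<noteq> b" by auto
  have "\<not> (Poly_Mapping.lookup t a \<noteq> 0 \<and> Poly_Mapping.lookup t b \<noteq> 0)"
    using t(2) ab(1) by (auto simp: covers_edge_def)
  then obtain w where w: "{u, w} \<in> E" "Poly_Mapping.lookup t w \<noteq> 0"
    using ab \<open>a \<noteq> b\<close>
    by (auto simp: lookup_add lookup_single when_def insert_commute split: if_splits)
  have "Var w \<notin> P"
  proof
    assume "Var w \<in> P"
    then have "covers_edge E (Poly_Mapping.single w 1 + t)" by (rule shift)
    moreover have "Poly_Mapping.lookup t x \<noteq> 0"
      if "Poly_Mapping.lookup (Poly_Mapping.single w 1 + t) x \<noteq> 0" for x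
      using that w(2) by (cases "x = w") (auto simp: lookup_add lookup_single when_def)
    ultimately have "covers_edge E t" unfolding covers_edge_def by blast
    then show False using t(2) by simp
  qed
  then show ?thesis using w(1) by blast
qed

text \<open>At an associated prime \<open>P\<close>, at most one variable of the clique is a unit; each of the others
  lies in the localized edge ideal, since some neighbour is a unit.\<close>

lemma clique_prod_in_symbolic_power:
  fixes K :: "'v::{finite, linorder} set"
  assumes E: "simple_graph E" and K: "clique E K"
  shows "(\<Prod>v\<in>K. Var v :: ('v, 'k::idom) mpoly) \<in> symbolic_power (edge_ideal E) (card K - 1)"
  unfolding symbolic_power_iff
proof
  fix P :: "('v, 'k) mpoly set" assume P: "P \<in> associated_primes (edge_ideal E)"
  then have prime: "is_prime_ideal P" by (simp add: associated_primes_def)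
  obtain f where Pf: "P = {r. r * f \<in> edge_ideal E}"
    using P by (auto simp: associated_primes_def)
  have sub: "edge_ideal E \<subseteq> P"
    using is_ideal_mult_left[OF is_ideal_edge_ideal[of E]] by (auto simp: Pf mult.commute)
  \<comment> \<open>Two distinct clique vertices are joined by an edge, so the product of their
    variables lies in \<open>P\<close>.\<close>
  have one: "u = v" if "u \<in> K" "v \<in> K" "Var u \<notin> P" "Var v \<notin> P" for u v
  proof (rule ccontr)
    assume "u \<noteq> v"
    then have "Var u * Var v \<in> P"
      using K that sub Var_mult_Var_in_edge_ideal[of u v E] by (auto simp: clique_def)
    then show False using that prime by (auto simp: is_prime_ideal_def)
  qed
  \<comment> \<open>If one clique variable is outside \<open>P\<close>, that one is dropped;
    otherwise the choice is arbitrary. For empty \<open>K\<close> the truncated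
    \<open>card K - 1\<close> is 0 and \<open>L\<close> is empty.\<close>
  obtain L where L: "L \<subseteq> K" "card L = card K - 1" "\<And>u. u \<in> L \<Longrightarrow> Var u \<in> P"
  proof (cases "\<forall>u\<in>K. Var u \<in> P")
    case True
    obtain L where "L \<subseteq> K" "card L = card K - 1"
      using obtain_subset_with_card_n[of "card K - 1" K] by auto
    with True show ?thesis using that by blast
  next
    case False
    then obtain u where "u \<in> K" "Var u \<notin> P" by blast
    then show ?thesis using one by (intro that[of "K - {u}"]) auto
  qed
  obtain w where w: "\<And>u. u \<in> L \<Longrightarrow> {u, w u} \<in> E \<and> Var (w u) \<notin> P"
    using associated_prime_neighbour[OF E P] L(3) by metis
  let ?s = "\<Prod>u\<in>L. Var (w u) :: ('v, 'k) mpoly"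
  have "?s \<notin> P" using w by (intro is_prime_ideal_prod[OF prime]) auto
  moreover have "?s * (\<Prod>v\<in>K. Var v) \<in> ideal_power (edge_ideal E) (card K - 1)"
  proof -
    have "(\<Prod>u\<in>L. Var u * Var (w u)) \<in> ideal_power (edge_ideal E :: ('v, 'k) mpoly set) (card L)"
      using w by (intro prod_in_ideal_power Var_mult_Var_in_edge_ideal) auto
    \<comment> \<open>Pairing each \<open>u\<close> in \<open>L\<close> with its neighbour
      \<open>w u\<close> produces \<open>card L\<close> generators; the variables of
      \<open>K - L\<close> are a harmless factor.\<close>
    moreover have "?s * (\<Prod>v\<in>K. Var v) = (\<Prod>v\<in>K - L. Var v) * (\<Prod>u\<in>L. Var u * Var (w u))"
      using prod.subset_diff[OF L(1), of "Var :: 'v \<Rightarrow> ('v, 'k) mpoly"]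
      by (simp add: prod.distrib algebra_simps)
    ultimately show ?thesis
      by (simp only: L(2) is_ideal_mult_left[OF is_ideal_ideal_power])
  qed
  ultimately show "\<exists>s. s \<notin> P \<and> s * (\<Prod>v\<in>K. Var v) \<in> ideal_power (edge_ideal E) (card K - 1)"
    by blast
qed

section \<open>Attainment of the chromatic and clique numbers\<close>

text \<open>Numbering the vertices injectively is a proper colouring, so the \<open>LEAST\<close>
  ranges over a nonempty set.\<close>

lemma chromatic_number_colouring:
  fixes E :: "'v::finite set set"
  assumes E: "simple_graph E"
  obtains h where "proper_colouring E (chromatic_number E) h"
proof -
  obtain h :: "'v \<Rightarrow> nat" where h: "bij_betw h UNIV {0..<card (UNIV :: 'v set)}"
    using ex_bij_betw_finite_nat[OF finite] by blast
  have "h u \<noteq> h v" if "{u, v} \<in> E" for u v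
  proof -
    have "card {u, v} = 2" using that E unfolding simple_graph_def by blast
    then have "u \<noteq> v" by auto
    then show ?thesis using injD[OF bij_betw_imp_inj_on[OF h]] by blast
  qed
  moreover have "h v < card (UNIV :: 'v set)" for v
    using bij_betw_apply[OF h, of v] by simp
  ultimately have "proper_colouring E (card (UNIV :: 'v set)) h"
    by (simp add: proper_colouring_def)
  then have "\<exists>h. proper_colouring E (chromatic_number E) h"
    unfolding chromatic_number_def
    by (intro LeastI[of "\<lambda>c. \<exists>h. proper_colouring E c h"] exI)
  then show ?thesis using that by blast
qed

lemma clique_number_clique:
  fixes E :: "'v::finite set set"
  obtains K where "clique E K" "card K = clique_number E"
    "\<And>C. clique E C \<Longrightarrow> card C \<le> clique_number E"
proof -
  have eq: "clique_number E = Max (card ` {C. clique E C})"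
    unfolding clique_number_def by (simp only: setcompr_eq_image)
  have "{} \<in> {C. clique E C}" by (simp add: clique_def)
  then have "clique_number E \<in> card ` {C. clique E C}"
    unfolding eq by (intro Max_in finite_imageI finite) blast
  then obtain K where K: "clique E K" "card K = clique_number E" by auto
  have "card C \<le> clique_number E" if "clique E C" for C
    unfolding eq by (intro Max_ge finite_imageI finite) (use that in simp)
  with K show ?thesis by (rule that)
qed

section \<open>Passage to the limit\<close>

theorem theorem6p3:
  fixes E :: "'v::{finite, linorder} set set"
    and I :: "('v, 'k::alg_closed_field) mpoly set"
  assumes "simple_graph E" and "E \<noteq> {}"
    and "I = edge_ideal E"
  shows "real (chromatic_number E) / (real (chromatic_number E) - 1) \<le> waldschmidt_constant I
       \<and> waldschmidt_constant I \<le> real (clique_number E) / (real (clique_number E) - 1)"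
proof -
  let ?a = "\<lambda>m. initial_degree (symbolic_power I m)"
  let ?c = "chromatic_number E" and ?w = "clique_number E"
  obtain e where e: "e \<in> E" using assms(2) by blast
  then have "card e = 2" using assms(1) by (simp add: simple_graph_def)
  then obtain x y where xy: "e = {x, y}" "x \<noteq> y" by (auto simp: card_2_iff)
  \<comment> \<open>A nonzero form in \<open>I\<close>, as required for convergence and for
    attaining the initial degrees.\<close>
  define q :: "('v, 'k) mpoly" where "q = Var x * Var y"
  have q: "q \<in> I" "q \<noteq> 0" "homogeneous 2 q"
    using Var_mult_Var_in_edge_ideal[of x y E] e xy
      homogeneous_mult[OF homogeneous_Var homogeneous_Var, of x y]
    by (auto simp: q_def assms(3) Var_neq_0 numeral_2_eq_2)
  have lim: "(\<lambda>m. real (?a m) / real m) \<longlonglongrightarrow> waldschmidt_constant I"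
    by (rule waldschmidt_constant_tendsto[OF q])
  obtain h where h: "proper_colouring E ?c h"
    using chromatic_number_colouring[OF assms(1)] by blast
  \<comment> \<open>This makes the denominator positive and the natural-number \<open>?c - 1\<close>
    agree with the real one.\<close>
  have c2: "2 \<le> ?c"
  proof -
    have "h x < ?c" "h y < ?c" "h x \<noteq> h y" using h e xy by (auto simp: proper_colouring_def)
    then show ?thesis by linarith
  qed
  have "real ?c / (real ?c - 1) \<le> real (?a m) / real m" if m: "m \<ge> 1" for m
  proof -
    have "q ^ m \<in> symbolic_power I m"
      using power_in_ideal_power[OF q(1)] ideal_power_subset_symbolic_power by blast
    then obtain g where "g \<in> symbolic_power I m" "g \<noteq> 0" "homogeneous (?a m) g"
      using initial_degree_attained[OF _ _ homogeneous_power[OF q(3)]] q(2) by (metis power_not_zero)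
    then have "?c * m \<le> (?c - 1) * ?a m"
      using colouring_degree_bound[OF assms(1) h] by (simp add: assms(3))
    then have "real (?c * m) \<le> real ((?c - 1) * ?a m)" by (rule of_nat_mono)
    then show ?thesis using c2 m by (simp add: of_nat_diff field_simps)
  qed
  then have lower: "real ?c / (real ?c - 1) \<le> waldschmidt_constant I"
    by (intro LIMSEQ_le_const[OF lim] exI[of _ 1]) simp
  obtain K where K: "clique E K" "card K = ?w" "\<And>C. clique E C \<Longrightarrow> card C \<le> ?w"
    using clique_number_clique by blast
  have w2: "2 \<le> ?w"
  proof -
    have "clique E {x, y}" using e xy by (auto simp: clique_def insert_commute)
    then show ?thesis using K(3)[of "{x, y}"] xy by simp
  qed
  define F :: "('v, 'k) mpoly" where "F = (\<Prod>v\<in>K. Var v)"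
  have F: "F \<in> symbolic_power I (?w - 1)" "F \<noteq> 0" "homogeneous ?w F"
    using clique_prod_in_symbolic_power[OF assms(1) K(1)] homogeneous_prod_Var[of K]
    by (auto simp: F_def assms(3) K(2) Var_neq_0)
  have upper_seq: "real (?a ((?w - 1) * j)) / real ((?w - 1) * j) \<le> real ?w / (real ?w - 1)"
    if j: "j \<ge> 1" for j
  proof -
    have "?a ((?w - 1) * j) \<le> ?w * j"
      using F by (intro initial_degree_le[of "F ^ j"] symbolic_power_power homogeneous_power) auto
    then have "real (?a ((?w - 1) * j)) \<le> real ?w * real j" by (simp flip: of_nat_mult)
    then have "real (?a ((?w - 1) * j)) / real ((?w - 1) * j) \<le> real ?w * real j / real ((?w - 1) * j)"
      by (rule divide_right_mono) simp
    also have "\<dots> = real ?w / (real ?w - 1)" using j w2 by (simp add: of_nat_diff)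
    finally show ?thesis .
  qed
  \<comment> \<open>As \<open>?w - 1\<close> is positive, its multiples index a subsequence; the
    full sequence converges, so a bound along this subsequence bounds the limit.\<close>
  have "strict_mono (\<lambda>j. (?w - 1) * j)" using w2 by (auto intro!: strict_monoI)
  then have "(\<lambda>j. real (?a ((?w - 1) * j)) / real ((?w - 1) * j)) \<longlonglongrightarrow> waldschmidt_constant I"
    by (rule LIMSEQ_subseq_LIMSEQ[OF lim, unfolded o_def])
  then have "waldschmidt_constant I \<le> real ?w / (real ?w - 1)"
    by (rule LIMSEQ_le_const2) (use upper_seq in \<open>intro exI[of _ 1] allI impI\<close>)
  with lower show ?thesis by blast
qed

end
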